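(* Let $n\ge 3$. Consider an $(n-1)$-rowed table whose positions are the pairs $(i,j)\in\mathbf{Z}^2$ with $1\le j-i\le n-1$ (position $(i,j)$ lying in row $j-i$), whose top row (row $1$) and bottom row (row $n-1$) consist entirely of 1's. Let $Z=\{p_2,\dots,p_{n-2}\}$ be a zig-zag joining the top row to the bottom row, and assign formal weights (independent indeterminates) $x_2,\dots,x_{n-2}$ to the $n-3$ positions $p_2,\dots,p_{n-2}$ respectively. Then: (a) there is a unique assignment of rational functions $F_{i,j}\in\mathbf{Q}(x_2,\dots,x_{n-2})$ to all the positions $(i,j)$ of the table, taking the value $x_r$ at $p_r$ for $2\le r\le n-2$ and the value $1$ at all positions in the top and bottom rows, such that the frieze relation $$F_{i,j}\,F_{i-1,j+1} = F_{i-1,j}\,F_{i,j+1}-1$$ is satisfied for all $i,j\in\mathbf{Z}$ with $1\le j-i\le n-3$; (b) these rational functions have the glide-reflection symmetry $F_{i,j}=F_{j,i+n}$ for all $i,j$ with $1\le j-i\le n-1$, which gives each row period $n$, i.e. $F_{i+n,j+n}=F_{i,j}$; (c) each $F_{i,j}$ is a Laurent polynomial in $x_2,\dots,x_{n-2}$ with positive coefficients.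
   Context: In the table, row $r$ consists of the positions $(i,i+r)$, $i\in\mathbf{Z}$, listed from left to right; each row is offset by half a position from the previous one, so that $(i-1,j+1)$ lies directly below $(i,j)$, with $(i-1,j)$ and $(i,j+1)$ being their common left and right neighbours in the intermediate row. The frieze relation for a diamond with top $A$, left $B$, right $C$, bottom $D$ is $AD=BC-1$. The glide-reflection symmetry says that row $n-m$ equals row $m$ shifted by $n/2$ positions. A zig-zag joining the top row to the bottom row is a choice of one position $p_r$ in each row $r=2,\dots,n-2$ such that for each $r$ with $2\le r\le n-3$, if $p_r=(i,j)$ then $p_{r+1}$ is either $(i-1,j)$ (a step down and to the left) or $(i,j+1)$ (a step down and to the right); the pattern of leftward and rightward steps is arbitrary. A Laurent polynomial with positive coefficients is a rational function that can be written as a finite linear combination of monomials with (possibly negative) integer exponents, all of whose non-zero coefficients are positive. *)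

theory Defs
  imports
    Complex_Main
    "HOL-Library.Poly_Mapping"
    "HOL-Library.FuncSet"
    "HOL-Computational_Algebra.Fraction_Field"
begin

section \<open>Rational functions over the rationals\<close>

text \<open>
  A monomial is a finitely supported map from variable indices to exponents, and a polynomial
  is a finitely supported map from monomials to coefficients, so that multiplication in
  \<^typ>\<open>(nat \<Rightarrow>\<^sub>0 nat) \<Rightarrow>\<^sub>0 rat\<close> (convolution) is multiplication in
  \<open>Q[x\<^sub>0, x\<^sub>1, x\<^sub>2, \<dots>]\<close>. The type \<open>ratfun\<close> is the fraction field of this polynomial ring.
\<close>

type_synonym rpoly = "(nat \<Rightarrow>\<^sub>0 nat) \<Rightarrow>\<^sub>0 rat"
type_synonym ratfun = "rpoly fract"

definition poly_vars :: "rpoly \<Rightarrow> nat set" where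
  "poly_vars f = (\<Union>m\<in>Poly_Mapping.keys f. Poly_Mapping.keys m)"

text \<open>The subfield \<open>Q(x\<^sub>k : k \<in> V)\<close>.\<close>

definition ratfuns :: "nat set \<Rightarrow> ratfun set" where
  "ratfuns V = {Fract f g | f g. g \<noteq> 0 \<and> poly_vars f \<subseteq> V \<and> poly_vars g \<subseteq> V}"

definition const :: "rat \<Rightarrow> ratfun" where
  "const c = Fract (Poly_Mapping.single 0 c) 1"

definition indet :: "nat \<Rightarrow> ratfun" where
  "indet k = Fract (Poly_Mapping.single (Poly_Mapping.single k 1) 1) 1"

definition laurent_monomial :: "(nat \<Rightarrow>\<^sub>0 int) \<Rightarrow> ratfun" where
  "laurent_monomial e = (\<Prod>k\<in>Poly_Mapping.keys e. indet k powi Poly_Mapping.lookup e k)"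

text \<open>
  The keys of \<open>L\<close> are exactly the exponent vectors with non-zero coefficient, so positivity is
  demanded of precisely the non-zero coefficients.
\<close>

definition positive_laurent :: "nat set \<Rightarrow> ratfun \<Rightarrow> bool" where
  "positive_laurent V f \<longleftrightarrow>
     (\<exists>L :: (nat \<Rightarrow>\<^sub>0 int) \<Rightarrow>\<^sub>0 rat.
        (\<forall>e\<in>Poly_Mapping.keys L. Poly_Mapping.keys e \<subseteq> V \<and> Poly_Mapping.lookup L e > 0) \<and>
        f = (\<Sum>e\<in>Poly_Mapping.keys L. const (Poly_Mapping.lookup L e) * laurent_monomial e))"

section \<open>Friezes\<close>

definition row :: "int \<times> int \<Rightarrow> int" where
  "row q = snd q - fst q"

definition positions :: "nat \<Rightarrow> (int \<times> int) set" where
  "positions n = {q. 1 \<le> row q \<and> row q \<le> int n - 1}"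

text \<open>Only the values \<open>p r\<close> with \<open>2 \<le> r \<le> n - 2\<close> are relevant.\<close>

definition zigzag :: "nat \<Rightarrow> (nat \<Rightarrow> int \<times> int) \<Rightarrow> bool" where
  "zigzag n p \<longleftrightarrow>
     (\<forall>r\<in>{2..n - 2}. row (p r) = int r) \<and>
     (\<forall>r\<in>{2..n - 3}. \<forall>i j. p r = (i, j) \<longrightarrow> p (Suc r) = (i - 1, j) \<or> p (Suc r) = (i, j + 1))"

definition frieze_relation :: "nat \<Rightarrow> (int \<times> int \<Rightarrow> ratfun) \<Rightarrow> bool" where
  "frieze_relation n F \<longleftrightarrow>
     (\<forall>i j. 1 \<le> j - i \<and> j - i \<le> int n - 3 \<longrightarrow>
        F (i, j) * F (i - 1, j + 1) = F (i - 1, j) * F (i, j + 1) - 1)"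

text \<open>
  An assignment of rational functions to the positions of the table only: the extensional
  function space fixes the (irrelevant) values of \<open>F\<close> outside the table, so that uniqueness of
  \<open>F\<close> means uniqueness of the assignment.
\<close>

definition frieze_with_weights ::
    "nat \<Rightarrow> (nat \<Rightarrow> int \<times> int) \<Rightarrow> (int \<times> int \<Rightarrow> ratfun) \<Rightarrow> bool" where
  "frieze_with_weights n p F \<longleftrightarrow>
     F \<in> positions n \<rightarrow>\<^sub>E ratfuns {2..n - 2} \<and>
     (\<forall>r\<in>{2..n - 2}. F (p r) = indet r) \<and>
     (\<forall>q. row q = 1 \<or> row q = int n - 1 \<longrightarrow> F q = 1) \<and>
     frieze_relation n F"

end

(* Write every entry as F(i,j) = det(v_i, v_j) for vectors v_i in the plane with
   det(v_i, v_(i+1)) = 1 and v_(i+n) = -v_i: the frieze relation is then the Pluecker relation and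
   the glide reflection is the antisymmetry of det. Along the zig-zag the interval [i,j] of indices
   grows by one at each step, and the new vector is (x_(r+1) v_j - v_i) / x_r on the right (similarly
   on the left), so that F(s,j+1) = (x_(r+1) F(s,j) + F(i,s)) / x_r. This recursion is
   subtraction-free and divides by monomials only, which gives positivity. *)
theory Submission
  imports Defs "HOL-Library.Product_Plus"
begin

section \<open>Subtraction-free Laurent polynomials\<close>

lemma poly_vars_one: "poly_vars 1 = {}"
  by (simp add: poly_vars_def)

lemma poly_vars_add_subset: "poly_vars (f + g) \<subseteq> poly_vars f \<union> poly_vars g"
  using Poly_Mapping.keys_add[of f g] by (auto simp: poly_vars_def)

lemma poly_vars_mult_subset: "poly_vars (f * g) \<subseteq> poly_vars f \<union> poly_vars g"
proof
  fix k assume "k \<in> poly_vars (f * g)"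
  then obtain m where m: "m \<in> Poly_Mapping.keys (f * g)" "k \<in> Poly_Mapping.keys m"
    by (auto simp: poly_vars_def)
  then obtain a b where "m = a + b" "a \<in> Poly_Mapping.keys f" "b \<in> Poly_Mapping.keys g"
    using Poly_Mapping.keys_mult[of f g] by auto
  then show "k \<in> poly_vars f \<union> poly_vars g"
    using m(2) Poly_Mapping.keys_add[of a b] by (auto simp: poly_vars_def)
qed

lemma poly_vars_indet: "poly_vars (Poly_Mapping.single (Poly_Mapping.single k 1) 1) = {k}"
  by (simp add: poly_vars_def)

section \<open>Polynomials with non-negative coefficients and their quotients\<close>

definition nonneg_coeffs :: "('a \<Rightarrow>\<^sub>0 'b::linordered_idom) \<Rightarrow> bool" where
  "nonneg_coeffs f \<longleftrightarrow> (\<forall>m. 0 \<le> Poly_Mapping.lookup f m)"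

lemma nonneg_coeffs_single: "0 \<le> c \<Longrightarrow> nonneg_coeffs (Poly_Mapping.single m c)"
  by (simp add: nonneg_coeffs_def lookup_single when_def)

lemma nonneg_coeffs_one: "nonneg_coeffs 1"
  by (simp add: nonneg_coeffs_def lookup_one when_def)

lemma nonneg_coeffs_add: "nonneg_coeffs f \<Longrightarrow> nonneg_coeffs g \<Longrightarrow> nonneg_coeffs (f + g)"
  by (simp add: nonneg_coeffs_def lookup_add)

lemma nonneg_coeffs_mult:
  fixes f g :: "'a::monoid_add \<Rightarrow>\<^sub>0 'b::linordered_idom"
  assumes "nonneg_coeffs f" "nonneg_coeffs g"
  shows "nonneg_coeffs (f * g)"
  using assms unfolding nonneg_coeffs_def lookup_mult Sum_any.expand_set
  by (auto intro!: sum_nonneg mult_nonneg_nonneg simp: when_def)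

text \<open>No cancellation can occur: two non-negative coefficients add up to 0 only if both are 0,
  so every coefficient of \<open>f\<close> would have to vanish.\<close>

lemma nonneg_coeffs_add_nonzero:
  assumes "nonneg_coeffs f" "nonneg_coeffs g" "f \<noteq> 0"
  shows "f + g \<noteq> 0"
proof
  assume "f + g = 0"
  then have "Poly_Mapping.lookup f m + Poly_Mapping.lookup g m = 0" for m
    by (metis lookup_add lookup_zero)
  then have "Poly_Mapping.lookup f m = 0" for m
    using assms(1,2) by (simp add: nonneg_coeffs_def add_nonneg_eq_0_iff)
  then show False
    using assms(3) by (simp add: poly_mapping_eq_iff fun_eq_iff)
qed

text \<open>Subtraction-free rational functions. Asking for \<open>f \<noteq> 0\<close> excludes the
  zero function and makes the class closed under inversion as well as under sums and products; the
  bound on the variables yields membership in \<open>ratfuns V\<close>.\<close>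

definition positive_ratfun :: "nat set \<Rightarrow> ratfun \<Rightarrow> bool" where
  "positive_ratfun V h \<longleftrightarrow> (\<exists>f g. h = Fract f g \<and> f \<noteq> 0 \<and> g \<noteq> 0 \<and>
     nonneg_coeffs f \<and> nonneg_coeffs g \<and> poly_vars f \<subseteq> V \<and> poly_vars g \<subseteq> V)"

lemma positive_ratfun_nonzero: "positive_ratfun V h \<Longrightarrow> h \<noteq> 0"
  by (auto simp: positive_ratfun_def Zero_fract_def eq_fract)

lemma positive_ratfun_in_ratfuns: "positive_ratfun V h \<Longrightarrow> h \<in> ratfuns V"
  by (auto simp: positive_ratfun_def ratfuns_def)

lemma positive_ratfun_one: "positive_ratfun V 1"
  unfolding positive_ratfun_def
  by (rule exI[of _ 1], rule exI[of _ 1])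
    (simp add: One_fract_def poly_vars_one nonneg_coeffs_one)

lemma positive_ratfun_add:
  assumes "positive_ratfun V h" "positive_ratfun V h'"
  shows "positive_ratfun V (h + h')"
proof -
  obtain f g where h: "h = Fract f g" "f \<noteq> 0" "g \<noteq> 0" "nonneg_coeffs f" "nonneg_coeffs g"
    "poly_vars f \<subseteq> V" "poly_vars g \<subseteq> V"
    using assms(1) by (auto simp: positive_ratfun_def)
  obtain f' g' where h': "h' = Fract f' g'" "f' \<noteq> 0" "g' \<noteq> 0" "nonneg_coeffs f'" "nonneg_coeffs g'"
    "poly_vars f' \<subseteq> V" "poly_vars g' \<subseteq> V"
    using assms(2) by (auto simp: positive_ratfun_def)
  have "h + h' = Fract (f * g' + f' * g) (g * g')"
    using h h' by simp
  moreover have "f * g' + f' * g \<noteq> 0"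
    using h h' by (intro nonneg_coeffs_add_nonzero nonneg_coeffs_mult) auto
  moreover have "poly_vars (f * g' + f' * g) \<subseteq> V" "poly_vars (g * g') \<subseteq> V"
    using h(6,7) h'(6,7) poly_vars_add_subset[of "f * g'" "f' * g"] poly_vars_mult_subset[of f g']
      poly_vars_mult_subset[of f' g] poly_vars_mult_subset[of g g'] by blast+
  ultimately show ?thesis
    unfolding positive_ratfun_def using h h' nonneg_coeffs_add nonneg_coeffs_mult
    by (metis mult_eq_0_iff)
qed

lemma positive_ratfun_mult:
  assumes "positive_ratfun V h" "positive_ratfun V h'"
  shows "positive_ratfun V (h * h')"
proof -
  obtain f g where h: "h = Fract f g" "f \<noteq> 0" "g \<noteq> 0" "nonneg_coeffs f" "nonneg_coeffs g"
    "poly_vars f \<subseteq> V" "poly_vars g \<subseteq> V"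
    using assms(1) by (auto simp: positive_ratfun_def)
  obtain f' g' where h': "h' = Fract f' g'" "f' \<noteq> 0" "g' \<noteq> 0" "nonneg_coeffs f'" "nonneg_coeffs g'"
    "poly_vars f' \<subseteq> V" "poly_vars g' \<subseteq> V"
    using assms(2) by (auto simp: positive_ratfun_def)
  have "h * h' = Fract (f * f') (g * g')"
    using h h' by simp
  moreover have "poly_vars (f * f') \<subseteq> V" "poly_vars (g * g') \<subseteq> V"
    using h(6,7) h'(6,7) poly_vars_mult_subset[of f f'] poly_vars_mult_subset[of g g'] by blast+
  ultimately show ?thesis
    unfolding positive_ratfun_def using h h' nonneg_coeffs_mult by (metis mult_eq_0_iff)
qed

lemma positive_ratfun_inverse: "positive_ratfun V h \<Longrightarrow> positive_ratfun V (inverse h)"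
  unfolding positive_ratfun_def by (metis inverse_fract)

lemma positive_ratfun_divide:
  "positive_ratfun V h \<Longrightarrow> positive_ratfun V h' \<Longrightarrow> positive_ratfun V (h / h')"
  by (simp add: divide_inverse positive_ratfun_mult positive_ratfun_inverse)

lemma positive_ratfun_indet:
  assumes "k \<in> V"
  shows "positive_ratfun V (indet k)"
proof -
  define f :: rpoly where "f = Poly_Mapping.single (Poly_Mapping.single k 1) 1"
  have "f \<noteq> 0"
    unfolding f_def by (metis lookup_single_eq lookup_zero zero_neq_one)
  then show ?thesis
    using assms unfolding positive_ratfun_def indet_def f_def[symmetric]
    by (intro exI[of _ f] exI[of _ 1])
      (auto simp: f_def poly_vars_one poly_vars_indet[simplified] nonneg_coeffs_single nonneg_coeffs_one)
qed

lemma indet_nonzero: "indet k \<noteq> 0"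
  using positive_ratfun_nonzero[OF positive_ratfun_indet] by blast

section \<open>Laurent monomials and Laurent polynomials with positive coefficients\<close>

lemma const_zero: "const 0 = 0"
  by (simp add: const_def Zero_fract_def)

lemma const_one: "const 1 = 1"
  by (simp add: const_def One_fract_def)

lemma const_add: "const (a + b) = const a + const b"
  by (simp add: const_def single_add)

text \<open>Exponents outside the support contribute factors 1, so monomials with different supports
  can be multiplied over one common index set.\<close>

lemma laurent_monomial_superset:
  assumes "finite K" "Poly_Mapping.keys e \<subseteq> K"
  shows "laurent_monomial e = (\<Prod>k\<in>K. indet k powi Poly_Mapping.lookup e k)"
  unfolding laurent_monomial_def using assms
  by (intro prod.mono_neutral_left) (auto simp: in_keys_iff)

lemma laurent_monomial_add:
  "laurent_monomial (e + e') = laurent_monomial e * laurent_monomial e'"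
proof -
  let ?K = "Poly_Mapping.keys e \<union> Poly_Mapping.keys e'"
  have "laurent_monomial (e + e') = (\<Prod>k\<in>?K. indet k powi Poly_Mapping.lookup (e + e') k)"
    by (rule laurent_monomial_superset) (use Poly_Mapping.keys_add[of e e'] in auto)
  also have "\<dots> = (\<Prod>k\<in>?K. indet k powi Poly_Mapping.lookup e k) *
      (\<Prod>k\<in>?K. indet k powi Poly_Mapping.lookup e' k)"
    by (simp add: lookup_add power_int_add indet_nonzero flip: prod.distrib)
  also have "\<dots> = laurent_monomial e * laurent_monomial e'"
    by (simp add: laurent_monomial_superset[of ?K])
  finally show ?thesis .
qed

lemma laurent_monomial_zero: "laurent_monomial 0 = 1"
  by (simp add: laurent_monomial_def)

lemma laurent_monomial_single: "laurent_monomial (Poly_Mapping.single k c) = indet k powi c"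
  by (simp add: laurent_monomial_def)

lemma positive_laurent_zero: "positive_laurent V 0"
  unfolding positive_laurent_def by (rule exI[of _ 0]) simp

lemma positive_laurent_term:
  assumes "0 < c" "Poly_Mapping.keys e \<subseteq> V"
  shows "positive_laurent V (const c * laurent_monomial e)"
  unfolding positive_laurent_def
  by (rule exI[of _ "Poly_Mapping.single e c"]) (use assms in simp)

lemma positive_laurent_add:
  assumes "positive_laurent V f" "positive_laurent V g"
  shows "positive_laurent V (f + g)"
proof -
  \<comment> \<open>The summation range \<open>K\<close> is kept separate from \<open>L\<close>, so
    that \<open>L\<close>, \<open>M\<close> and \<open>L + M\<close> can all be evaluated over the
    union of the two supports; extra keys contribute 0.\<close>
  define S where "S L K = (\<Sum>e\<in>K. const (Poly_Mapping.lookup L e) * laurent_monomial e)"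
    for L :: "(nat \<Rightarrow>\<^sub>0 int) \<Rightarrow>\<^sub>0 rat" and K
  have S: "S L K = S L (Poly_Mapping.keys L)" if "finite K" "Poly_Mapping.keys L \<subseteq> K" for L K
    unfolding S_def using that
    by (intro sum.mono_neutral_right) (auto simp: in_keys_iff const_zero)
  obtain L M where L: "\<forall>e\<in>Poly_Mapping.keys L. Poly_Mapping.keys e \<subseteq> V \<and> Poly_Mapping.lookup L e > 0"
      "f = S L (Poly_Mapping.keys L)"
    and M: "\<forall>e\<in>Poly_Mapping.keys M. Poly_Mapping.keys e \<subseteq> V \<and> Poly_Mapping.lookup M e > 0"
      "g = S M (Poly_Mapping.keys M)"
    using assms unfolding positive_laurent_def S_def by blast
  let ?K = "Poly_Mapping.keys L \<union> Poly_Mapping.keys M"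
  \<comment> \<open>Coefficients outside the support are 0, hence all are non-negative, and a
    non-zero coefficient of \<open>L + M\<close> must be positive.\<close>
  have nonneg: "0 \<le> Poly_Mapping.lookup L e" "0 \<le> Poly_Mapping.lookup M e" for e
    using L(1) M(1) by (metis in_keys_iff less_imp_le order_refl)+
  have sub: "Poly_Mapping.keys (L + M) \<subseteq> ?K"
    by (rule Poly_Mapping.keys_add)
  have "\<forall>e\<in>Poly_Mapping.keys (L + M). Poly_Mapping.keys e \<subseteq> V \<and> Poly_Mapping.lookup (L + M) e > 0"
  proof
    fix e assume e: "e \<in> Poly_Mapping.keys (L + M)"
    then have "Poly_Mapping.lookup (L + M) e \<noteq> 0"
      by (simp add: in_keys_iff)
    then show "Poly_Mapping.keys e \<subseteq> V \<and> Poly_Mapping.lookup (L + M) e > 0"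
      using e sub L(1) M(1) nonneg[of e] by (auto simp: lookup_add order_less_le)
  qed
  moreover have "f + g = S (L + M) (Poly_Mapping.keys (L + M))"
  proof -
    have "f + g = S L ?K + S M ?K"
      using L(2) M(2) S[of ?K L] S[of ?K M] by simp
    also have "\<dots> = S (L + M) ?K"
      by (simp add: S_def lookup_add const_add algebra_simps flip: sum.distrib)
    also have "\<dots> = S (L + M) (Poly_Mapping.keys (L + M))"
      using sub by (intro S) auto
    finally show ?thesis .
  qed
  ultimately show ?thesis
    unfolding positive_laurent_def S_def by blast
qed

lemma positive_laurent_sum:
  "(\<And>a. a \<in> A \<Longrightarrow> positive_laurent V (f a)) \<Longrightarrow> positive_laurent V (\<Sum>a\<in>A. f a)"
  by (induction A rule: infinite_finite_induct)
    (simp_all add: positive_laurent_zero positive_laurent_add)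

text \<open>A monomial factor translates the exponents by \<open>d\<close> and leaves the
  coefficients unchanged. Taking \<open>d\<close> to be 1 or -1 at a single index covers
  multiplication and division by an indeterminate, the operations of the zig-zag recursion.\<close>

lemma positive_laurent_mult_monomial:
  assumes "positive_laurent V f" "Poly_Mapping.keys d \<subseteq> V"
  shows "positive_laurent V (laurent_monomial d * f)"
proof -
  obtain L where L: "\<forall>e\<in>Poly_Mapping.keys L. Poly_Mapping.keys e \<subseteq> V \<and> Poly_Mapping.lookup L e > 0"
      "f = (\<Sum>e\<in>Poly_Mapping.keys L. const (Poly_Mapping.lookup L e) * laurent_monomial e)"
    using assms unfolding positive_laurent_def by blast
  have "laurent_monomial d * f =
      (\<Sum>e\<in>Poly_Mapping.keys L. const (Poly_Mapping.lookup L e) * laurent_monomial (d + e))"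
    by (simp add: L(2) sum_distrib_left laurent_monomial_add mult_ac)
  moreover have "Poly_Mapping.keys (d + e) \<subseteq> V" if "e \<in> Poly_Mapping.keys L" for e
    using that L(1) assms(2) Poly_Mapping.keys_add[of d e] by blast
  ultimately show ?thesis
    using L(1) by (auto intro!: positive_laurent_sum positive_laurent_term)
qed

lemma positive_laurent_one: "positive_laurent V 1"
  using positive_laurent_term[of 1 0 V] by (simp add: const_one laurent_monomial_zero)

lemma positive_laurent_mult_indet:
  assumes "positive_laurent V f" "k \<in> V"
  shows "positive_laurent V (indet k * f)"
  using positive_laurent_mult_monomial[OF assms(1), of "Poly_Mapping.single k 1"] assms(2)
  by (simp add: laurent_monomial_single)

lemma positive_laurent_divide_indet:
  assumes "positive_laurent V f" "k \<in> V"
  shows "positive_laurent V (f / indet k)"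
  using positive_laurent_mult_monomial[OF assms(1), of "Poly_Mapping.single k (- 1)"] assms(2)
  by (simp add: laurent_monomial_single power_int_minus field_simps)


section \<open>Friezes from pairs of sequences\<close>

text \<open>The 2 by 2 determinant with columns \<open>v s\<close> and \<open>v t\<close>: a
  Pluecker coordinate of the sequence \<open>v\<close>.\<close>

definition wedge :: "(int \<Rightarrow> 'a \<times> 'a) \<Rightarrow> int \<Rightarrow> int \<Rightarrow> 'a::comm_ring_1" where
  "wedge v s t = fst (v s) * snd (v t) - snd (v s) * fst (v t)"

lemma wedge_self: "wedge v t t = 0"
  by (simp add: wedge_def)

lemma wedge_skew: "wedge v t s = - wedge v s t"
  by (simp add: wedge_def)

text \<open>The three-term Pluecker relation; as in Ptolemy's theorem, the product of the diagonals
  of a quadrilateral \<open>a, b, c, d\<close> is the sum of the products of opposite sides.\<close>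

lemma wedge_plucker:
  "wedge v a c * wedge v b d = wedge v a b * wedge v c d + wedge v a d * wedge v b c"
  by (simp add: wedge_def algebra_simps)

text \<open>Row \<open>r\<close> of the zig-zag is encoded by the interval from \<open>c r\<close>
  to \<open>c r + r\<close>. A step extends it by one index on the right (\<open>c\<close>
  unchanged) or on the left (\<open>c\<close> drops by 1), so the intervals are nested.\<close>

lemma zigzag_endpoints_mono:
  fixes c :: "nat \<Rightarrow> int"
  assumes step: "\<And>r. c (Suc r) = c r \<or> c (Suc r) = c r - 1" and "k \<le> r"
  shows "c r \<le> c k \<and> c k + int k \<le> c r + int r"
  using \<open>k \<le> r\<close>
proof (induction r rule: dec_induct)
  case (step r)
  then show ?case
    using assms(1)[of r] by auto
qed simp

text \<open>Induction down the zig-zag, one new vector per row, with the earlier vectors kept.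
  \<open>Q\<close> is abstract so that a single induction delivers every property preserved by sums
  and by multiplication and division by weights.\<close>

lemma zigzag_vectors:
  fixes c :: "nat \<Rightarrow> int" and X :: "nat \<Rightarrow> 'a::field"
  assumes step: "\<And>r. c (Suc r) = c r \<or> c (Suc r) = c r - 1"
    and X_nz: "\<And>r. X r \<noteq> 0" and X_one: "X 1 = 1"
    and Q_one: "Q 1" and Q_add: "\<And>a b. Q a \<Longrightarrow> Q b \<Longrightarrow> Q (a + b)"
    and Q_mult: "\<And>r a. Q a \<Longrightarrow> Q (X r * a)" and Q_divide: "\<And>r a. Q a \<Longrightarrow> Q (a / X r)"
    and "1 \<le> r"
  shows "\<exists>v. (\<forall>t. c r \<le> t \<and> t < c r + int r \<longrightarrow> wedge v t (t + 1) = 1) \<and>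
    (\<forall>k. 1 \<le> k \<and> k \<le> r \<longrightarrow> wedge v (c k) (c k + int k) = X k) \<and>
    (\<forall>s t. c r \<le> s \<and> s < t \<and> t \<le> c r + int r \<longrightarrow> Q (wedge v s t))"
  using \<open>1 \<le> r\<close>
proof (induction r rule: dec_induct)
  case base
  \<comment> \<open>Any two vectors of determinant 1 would start the induction; the standard basis
    is taken.\<close>
  define v where "v t = (if t = c 1 then (1, 0) else (0, 1) :: 'a \<times> 'a)" for t
  have v: "wedge v (c 1) (c 1 + 1) = 1"
    by (simp add: wedge_def v_def)
  have "wedge v t (t + 1) = 1" if "c 1 \<le> t" "t < c 1 + int 1" for t
  proof -
    have "t = c 1"
      using that by simp
    then show ?thesis
      using v by simp
  qed
  moreover have "wedge v (c k) (c k + int k) = X k" if "1 \<le> k" "k \<le> 1" for k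
  proof -
    have "k = 1"
      using that by simp
    then show ?thesis
      using v X_one by simp
  qed
  moreover have "Q (wedge v s t)" if "c 1 \<le> s" "s < t" "t \<le> c 1 + int 1" for s t
  proof -
    have "s = c 1" "t = c 1 + 1"
      using that by simp_all
    then show ?thesis
      using v Q_one by simp
  qed
  ultimately show ?case
    by blast
next
  case (step r)
  then obtain v where v1: "\<And>t. c r \<le> t \<Longrightarrow> t < c r + int r \<Longrightarrow> wedge v t (t + 1) = 1"
    and vX: "\<And>k. 1 \<le> k \<Longrightarrow> k \<le> r \<Longrightarrow> wedge v (c k) (c k + int k) = X k"
    and vQ: "\<And>s t. c r \<le> s \<Longrightarrow> s < t \<Longrightarrow> t \<le> c r + int r \<Longrightarrow> Q (wedge v s t)"
    by blast
  define i j where "i = c r" and "j = c r + int r"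
  have "i < j"
    using step by (simp add: i_def j_def)
  have ij: "wedge v i j = X r"
    using vX[of r] step by (simp add: i_def j_def)
  have Q_X: "Q (X r)" for r
    using Q_mult[OF Q_one] by simp
  show ?case
  proof (cases "c (Suc r) = c r")
    case True
    \<comment> \<open>Since \<open>v i\<close> and \<open>v j\<close> have determinant
      \<open>X r\<close>, which is non-zero, they form a basis, and this is the only vector whose
      determinant with \<open>v j\<close> is 1 and with \<open>v i\<close> is
      \<open>X (Suc r)\<close>.\<close>
    define v' where "v' = v(j + 1 := ((X (Suc r) * fst (v j) - fst (v i)) / X r,
                                      (X (Suc r) * snd (v j) - snd (v i)) / X r))"
    have old: "wedge v' s t = wedge v s t" if "s \<le> j" "t \<le> j" for s t
      using that by (simp add: v'_def wedge_def)
    \<comment> \<open>The minus sign in the new vector is absorbed by antisymmetry: the term -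
      \<open>wedge v s i\<close> becomes + \<open>wedge v i s\<close>.\<close>
    have new: "wedge v' s (j + 1) = (X (Suc r) * wedge v s j + wedge v i s) / X r" if "s \<le> j" for s
      using that by (simp add: v'_def wedge_def field_simps X_nz)
    have new_j: "wedge v' j (j + 1) = 1"
      by (simp add: new wedge_self ij X_nz)
    have new_i: "wedge v' i (j + 1) = X (Suc r)"
      using \<open>i < j\<close> by (simp add: new wedge_self ij X_nz)
    have "wedge v' t (t + 1) = 1" if "i \<le> t" "t < j + 1" for t
      using that new_j old[of t "t + 1"] v1[of t] by (cases "t = j") (auto simp: i_def j_def)
    moreover have "wedge v' (c k) (c k + int k) = X k" if "1 \<le> k" "k \<le> Suc r" for k
    proof (cases "k = Suc r")
      case True
      then show ?thesis
        using new_i \<open>c (Suc r) = c r\<close> by (simp add: i_def j_def add_ac)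
    next
      case False
      then have "k \<le> r"
        using that by simp
      then have "c k + int k \<le> j"
        using zigzag_endpoints_mono[of c k r] assms(1) by (auto simp: j_def)
      then show ?thesis
        using old vX[of k] that \<open>k \<le> r\<close> by simp
    qed
    moreover have "Q (wedge v' s t)" if st: "i \<le> s" "s < t" "t \<le> j + 1" for s t
    proof (cases "t = j + 1")
      case False
      then show ?thesis
        using st old vQ[of s t] by (simp add: i_def j_def)
    next
      case True
      \<comment> \<open>At \<open>s = i\<close> and \<open>s = j\<close> one summand of the
        recursion is the determinant of a vector with itself, that is 0, where \<open>Q\<close> is
        not assumed. These two entries are the values \<open>X (Suc r)\<close> and 1
        instead.\<close>
      consider "s = i" | "s = j" | "i < s" "s < j"
        using st True by linarith
      then show ?thesis
      proof cases
        case 3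
        then have "Q (wedge v s j)" "Q (wedge v i s)"
          using vQ by (auto simp: i_def j_def)
        then show ?thesis
          using 3 True by (simp add: new Q_add Q_mult Q_divide)
      qed (simp_all add: True new_i new_j Q_X Q_one)
    qed
    moreover have "c (Suc r) = i" "c (Suc r) + int (Suc r) = j + 1"
      using True by (simp_all add: i_def j_def)
    ultimately show ?thesis
      by (intro exI[of _ v']) (simp only:, blast)
  next
    case False
    then have left: "c (Suc r) = i - 1"
      using assms(1)[of r] by (simp add: i_def)
    \<comment> \<open>The mirror image of the right step: the new vector is put in front of
      \<open>i\<close>, and \<open>i\<close> and \<open>j\<close> exchange roles.\<close>
    define v' where "v' = v(i - 1 := ((X (Suc r) * fst (v i) - fst (v j)) / X r,
                                      (X (Suc r) * snd (v i) - snd (v j)) / X r))"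
    have old: "wedge v' s t = wedge v s t" if "i \<le> s" "i \<le> t" for s t
      using that by (simp add: v'_def wedge_def)
    have new: "wedge v' (i - 1) t = (X (Suc r) * wedge v i t + wedge v t j) / X r" if "i \<le> t" for t
      using that by (simp add: v'_def wedge_def field_simps X_nz)
    have new_i: "wedge v' (i - 1) i = 1"
      by (simp add: new wedge_self ij X_nz)
    have new_j: "wedge v' (i - 1) j = X (Suc r)"
      using \<open>i < j\<close> by (simp add: new wedge_self ij X_nz)
    have "wedge v' t (t + 1) = 1" if "i - 1 \<le> t" "t < j" for t
      using that new_i old[of t "t + 1"] v1[of t] by (cases "t = i - 1") (auto simp: i_def j_def)
    moreover have "wedge v' (c k) (c k + int k) = X k" if "1 \<le> k" "k \<le> Suc r" for k
    proof (cases "k = Suc r")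
      case True
      then show ?thesis
        using new_j left by (simp add: i_def j_def add_ac)
    next
      case False
      then have "k \<le> r"
        using that by simp
      then have "i \<le> c k"
        using zigzag_endpoints_mono[of c k r] assms(1) by (auto simp: i_def)
      then show ?thesis
        using old vX[of k] that \<open>k \<le> r\<close> by simp
    qed
    moreover have "Q (wedge v' s t)" if st: "i - 1 \<le> s" "s < t" "t \<le> j" for s t
    proof (cases "s = i - 1")
      case False
      then show ?thesis
        using st old vQ[of s t] by (simp add: i_def j_def)
    next
      case True
      consider "t = i" | "t = j" | "i < t" "t < j"
        using st True by linarith
      then show ?thesis
      proof cases
        case 3
        then have "Q (wedge v i t)" "Q (wedge v t j)"
          using vQ by (auto simp: i_def j_def)
        then show ?thesis
          using 3 True by (simp add: new Q_add Q_mult Q_divide)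
      qed (simp_all add: True new_i new_j Q_X Q_one)
    qed
    moreover have "c (Suc r) + int (Suc r) = j"
      using left by (simp add: i_def j_def)
    ultimately show ?thesis
      using left by (intro exI[of _ v']) (simp only:, blast)
  qed
qed

section \<open>Antiperiodic extension of \<open>n\<close> consecutive vectors to all
  integers\<close>

definition antiperiodic :: "nat \<Rightarrow> int \<Rightarrow> (int \<Rightarrow> 'a \<times> 'a) \<Rightarrow> int \<Rightarrow> 'a \<times> 'a::comm_ring_1" where
  "antiperiodic n b v t = (if even ((t - b) div int n) then v (b + (t - b) mod int n)
     else - v (b + (t - b) mod int n))"

text \<open>A shift by \<open>n\<close> moves to the next block, whose parity and hence sign is
  opposite, and the determinant is linear in each argument.\<close>

lemma wedge_antiperiodic_shift:
  assumes "n > 0"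
  shows "wedge (antiperiodic n b v) s (t + int n) = - wedge (antiperiodic n b v) s t"
    and "wedge (antiperiodic n b v) (s + int n) t = - wedge (antiperiodic n b v) s t"
proof -
  have "antiperiodic n b v (t + int n) = - antiperiodic n b v t" for t
  proof -
    have "(t - b + int n) div int n = (t - b) div int n + 1"
      "(t - b + int n) mod int n = (t - b) mod int n"
      using assms by simp_all
    moreover have "t - b + int n = t + int n - b"
      by simp
    ultimately show ?thesis
      by (simp add: antiperiodic_def)
  qed
  then show "wedge (antiperiodic n b v) s (t + int n) = - wedge (antiperiodic n b v) s t"
    "wedge (antiperiodic n b v) (s + int n) t = - wedge (antiperiodic n b v) s t"
    by (simp_all add: wedge_def)
qed

lemma wedge_antiperiodic_base:
  assumes "b \<le> s" "s < b + int n" "b \<le> t" "t < b + int n"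
  shows "wedge (antiperiodic n b v) s t = wedge v s t"
proof -
  have "antiperiodic n b v t = v t" if "b \<le> t" "t < b + int n" for t
    using that by (simp add: antiperiodic_def div_pos_pos_trivial mod_pos_pos_trivial)
  then show ?thesis
    using assms by (simp add: wedge_def)
qed

text \<open>Shifting both indices by \<open>n\<close> changes the sign twice; induction in both
  directions covers every integer multiple.\<close>

lemma wedge_antiperiodic_period:
  assumes "n > 0"
  shows "wedge (antiperiodic n b v) (s + m * int n) (t + m * int n) = wedge (antiperiodic n b v) s t"
proof (induction m rule: int_induct[where k = 0])
  case (step1 i)
  then show ?case
    using wedge_antiperiodic_shift[OF assms, of b v "s + i * int n" "t + i * int n + int n"]
      wedge_antiperiodic_shift[OF assms, of b v "s + i * int n" "t + i * int n"]
    by (simp add: algebra_simps)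
next
  case (step2 i)
  then show ?case
    using wedge_antiperiodic_shift[OF assms, of b v "s + (i - 1) * int n" "t + (i - 1) * int n + int n"]
      wedge_antiperiodic_shift[OF assms, of b v "s + (i - 1) * int n" "t + (i - 1) * int n"]
    by (simp add: algebra_simps)
qed simp

text \<open>An entry with both indices in one block of length \<open>n\<close> is an entry of \<open>v\<close>; if the block
  boundary separates the indices, the sign change cancels that of the transposition.\<close>

lemma wedge_antiperiodic_cases:
  assumes "n > 0" "s < t" "t < s + int n"
  obtains s' t' where "b \<le> s'" "s' < t'" "t' < b + int n"
    "wedge (antiperiodic n b v) s t = wedge v s' t'"
    "t' - s' = t - s \<or> t' - s' = int n - (t - s)"
proof -
  let ?w = "antiperiodic n b v"
  \<comment> \<open>Both indices are moved back by \<open>m\<close> blocks, which puts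
    \<open>s\<close> into the block starting at \<open>b\<close>; the other index then lies in that
    block or in the next one.\<close>
  define m where "m = (s - b) div int n"
  define a where "a = s - m * int n"
  define d where "d = t - m * int n"
  have "a = b + (s - b) mod int n"
    unfolding a_def m_def by (simp add: minus_div_mult_eq_mod[symmetric])
  then have a: "b \<le> a" "a < b + int n"
    using assms(1) by simp_all
  have ad: "a < d" "d < a + int n" "d - a = t - s"
    using assms by (simp_all add: a_def d_def)
  have eq: "wedge ?w s t = wedge ?w a d"
    using wedge_antiperiodic_period[OF assms(1), of b v a m d] by (simp add: a_def d_def)
  show thesis
  proof (cases "d < b + int n")
    case True
    then show thesis
      using that[of a d] a ad eq wedge_antiperiodic_base[of b a n d v] by simp
  next
    case False
    have "wedge ?w a d = - wedge ?w a (d - int n)"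
      using wedge_antiperiodic_shift(1)[OF assms(1), of b v a "d - int n"] by simp
    also have "\<dots> = wedge ?w (d - int n) a"
      by (simp add: wedge_skew[of ?w a])
    also have "\<dots> = wedge v (d - int n) a"
      using False a ad by (intro wedge_antiperiodic_base) auto
    finally show thesis
      using that[of "d - int n" a] False a ad eq by simp
  qed
qed


section \<open>Existence, uniqueness, symmetry and positivity\<close>

text \<open>The frieze relation determines the right-hand (left-hand) entry of a diamond from the three
  others, because the opposite entry is non-zero.\<close>

lemma frieze_propagate:
  fixes c :: "nat \<Rightarrow> int" and F G :: "int \<times> int \<Rightarrow> 'a::field"
  assumes step: "\<And>r. c (Suc r) = c r \<or> c (Suc r) = c r - 1"
    and relF: "\<And>i j. 1 \<le> j - i \<Longrightarrow> j - i \<le> int n - 3 \<Longrightarrow>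
      F (i, j) * F (i - 1, j + 1) = F (i - 1, j) * F (i, j + 1) - 1"
    and relG: "\<And>i j. 1 \<le> j - i \<Longrightarrow> j - i \<le> int n - 3 \<Longrightarrow>
      G (i, j) * G (i - 1, j + 1) = G (i - 1, j) * G (i, j + 1) - 1"
    and G_nz: "\<And>i j. 1 \<le> j - i \<Longrightarrow> j - i \<le> int n - 1 \<Longrightarrow> G (i, j) \<noteq> 0"
    and border: "\<And>i j. j - i = 1 \<or> j - i = int n - 1 \<Longrightarrow> F (i, j) = G (i, j)"
    and zigzag: "\<And>r. 1 \<le> r \<Longrightarrow> int r \<le> int n - 1 \<Longrightarrow> F (c r, c r + int r) = G (c r, c r + int r)"
    and r: "1 \<le> r" "int r \<le> int n - 1"
  shows "F (i, i + int r) = G (i, i + int r)"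
proof (cases "c r \<le> i")
  case True
  with r show ?thesis
  \<comment> \<open>The measure is the horizontal coordinate \<open>2 * i + r\<close> of the entry,
    counted from \<open>2 * c n\<close>, which lies to the left of everything considered because
    \<open>c n\<close> is at most \<open>c r\<close>.\<close>
  proof (induction "nat (2 * i + int r - 2 * c n)" arbitrary: i r rule: less_induct)
    case less
    show ?case
    proof (cases "i = c r \<or> r = 1 \<or> int r = int n - 1")
      case True
      then show ?thesis
        using zigzag[of r] border[of "i + int r" i] less.prems by auto
    next
      case False
      \<comment> \<open>With this \<open>j\<close> the entry is the right corner of the diamond with
        top \<open>(i, j)\<close>. Top and bottom lie one unit further left, the left corner two
        units, and all three stay on or to the right of the zig-zag.\<close>
      define j where "j = i + int r - 1"
      obtain q where q: "r = Suc q"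
        using less.prems by (cases r) auto
      have "c n \<le> c r"
        using zigzag_endpoints_mono[of c r n] step less.prems by auto
      then have bound: "0 < 2 * i + int r - 2 * c n"
        using less.prems by linarith
      have A: "F (i, j) = G (i, j)"
        using less.hyps[where i = i and r = q] step[of q] less.prems False bound q by (auto simp: j_def)
      have B: "F (i - 1, j) = G (i - 1, j)"
        using less.hyps[where i = "i - 1" and r = r] less.prems False bound
        by (auto simp: j_def algebra_simps)
      have D: "F (i - 1, j + 1) = G (i - 1, j + 1)"
        using less.hyps[where i = "i - 1" and r = "Suc r"] step[of r] less.prems False bound
        by (auto simp: j_def)
      have range: "1 \<le> j - i" "j - i \<le> int n - 3"
        using less.prems False by (auto simp: j_def)
      have "G (i - 1, j) * F (i, j + 1) = G (i - 1, j) * G (i, j + 1)"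
        using relF[OF range] relG[OF range] A B D by auto
      moreover have "G (i - 1, j) \<noteq> 0"
        using range by (intro G_nz) auto
      ultimately show ?thesis
        by (simp add: j_def)
    qed
  qed
next
  case False
  then have "i \<le> c r"
    by simp
  with r show ?thesis
  \<comment> \<open>The mirrored measure decreases to the right; it is positive because
    \<open>i\<close> is at most \<open>c 1\<close> and \<open>r\<close> is less than
    \<open>n\<close>.\<close>
  proof (induction "nat (2 * c 1 + int n - 2 * i - int r)" arbitrary: i r rule: less_induct)
    case less
    show ?case
    proof (cases "i = c r \<or> r = 1 \<or> int r = int n - 1")
      case True
      then show ?thesis
        using zigzag[of r] border[of "i + int r" i] less.prems by auto
    next
      case False
      \<comment> \<open>Here the entry is the left corner of the diamond with top
        \<open>(i + 1, j)\<close>.\<close>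
      define j where "j = i + int r"
      obtain q where q: "r = Suc q"
        using less.prems by (cases r) auto
      have "c r \<le> c 1"
        using zigzag_endpoints_mono[of c 1 r] step less.prems by auto
      then have bound: "0 < 2 * c 1 + int n - 2 * i - int r"
        using less.prems by linarith
      have A: "F (i + 1, j) = G (i + 1, j)"
        using less.hyps[where i = "i + 1" and r = q] step[of q] less.prems False bound q
        by (auto simp: j_def add_ac)
      have C: "F (i + 1, j + 1) = G (i + 1, j + 1)"
        using less.hyps[where i = "i + 1" and r = r] less.prems False bound by (auto simp: j_def add_ac)
      have D: "F (i, j + 1) = G (i, j + 1)"
        using less.hyps[where i = i and r = "Suc r"] step[of r] less.prems False bound
        by (auto simp: j_def add_ac)
      have range: "1 \<le> j - (i + 1)" "j - (i + 1) \<le> int n - 3"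
        using less.prems False by (auto simp: j_def)
      have "F (i, j) * G (i + 1, j + 1) = G (i, j) * G (i + 1, j + 1)"
        using relF[OF range] relG[OF range] A C D by simp
      moreover have "G (i + 1, j + 1) \<noteq> 0"
        using range by (intro G_nz) auto
      ultimately show ?thesis
        by (simp add: j_def)
    qed
  qed
qed

text \<open>The condition \<open>vn\<close> closes the sequence up: across a block boundary the
  determinant of neighbours is that of \<open>v (b + n - 1)\<close> and - \<open>v b\<close>, which
  is \<open>wedge v b (b + n - 1)\<close>. Hence all neighbours have determinant 1.\<close>

lemma antiperiodic_frieze:
  fixes v :: "int \<Rightarrow> 'a \<times> 'a::comm_ring_1"
  assumes "n > 1"
    and v1: "\<And>t. b \<le> t \<Longrightarrow> t < b + int n - 1 \<Longrightarrow> wedge v t (t + 1) = 1"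
    and vn: "wedge v b (b + int n - 1) = 1"
  shows "wedge (antiperiodic n b v) t (t + 1) = 1"
    and "wedge (antiperiodic n b v) t (t + int n - 1) = 1"
    and "wedge (antiperiodic n b v) i j * wedge (antiperiodic n b v) (i - 1) (j + 1) =
      wedge (antiperiodic n b v) (i - 1) j * wedge (antiperiodic n b v) i (j + 1) - 1"
proof -
  let ?w = "antiperiodic n b v"
  have n: "n > 0"
    using assms(1) by simp
  show one: "wedge ?w t (t + 1) = 1" for t
  proof -
    obtain s' t' where st: "b \<le> s'" "s' < t'" "t' < b + int n" "wedge ?w t (t + 1) = wedge v s' t'"
      "t' - s' = (t + 1) - t \<or> t' - s' = int n - ((t + 1) - t)"
      using wedge_antiperiodic_cases[OF n, of t "t + 1" b v] assms(1) by auto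
    from st(5) show ?thesis
    proof
      assume "t' - s' = (t + 1) - t"
      then have "t' = s' + 1"
        by simp
      then show ?thesis
        using st v1[of s'] by simp
    next
      assume "t' - s' = int n - ((t + 1) - t)"
      then have "s' = b" "t' = b + int n - 1"
        using st by auto
      then show ?thesis
        using st vn by simp
    qed
  qed
  \<comment> \<open>The bottom row is the glide image of the top row: transposing and then shifting
    by \<open>n\<close> gives a determinant of neighbours.\<close>
  show "wedge ?w t (t + int n - 1) = 1"
    using one[of "t + int n - 1"] wedge_antiperiodic_shift(1)[OF n, of b v "t + int n - 1" t]
    by (simp add: wedge_skew[of ?w t])
  \<comment> \<open>In this order of the four indices the left side of the Pluecker relation is a
    product of two determinants of neighbours, hence 1.\<close>
  show "wedge ?w i j * wedge ?w (i - 1) (j + 1) = wedge ?w (i - 1) j * wedge ?w i (j + 1) - 1"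
    using wedge_plucker[of ?w "i - 1" j i "j + 1"] one[of "i - 1"] one[of j]
    by (simp add: algebra_simps)
qed

theorem theorem3p1:
  fixes n :: nat and p :: "nat \<Rightarrow> int \<times> int"
  assumes "n \<ge> 3" and "zigzag n p"
  shows "(\<exists>!F. frieze_with_weights n p F) \<and>
    (\<forall>F. frieze_with_weights n p F \<longrightarrow>
       (\<forall>i j. 1 \<le> j - i \<and> j - i \<le> int n - 1 \<longrightarrow>
          F (i, j) = F (j, i + int n) \<and>
          F (i + int n, j + int n) = F (i, j) \<and>
          positive_laurent {2..n - 2} (F (i, j))))"
proof -
  define V where "V = {2..n - 2}"
  \<comment> \<open>Clamping the row index makes \<open>c\<close> constant before row 2 and after
    row \<open>n - 2\<close>, so the step condition holds for all \<open>r\<close> and the zig-zag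
    extends into both border rows.\<close>
  define c where "c r = fst (p (max 2 (min r (n - 2))))" for r
  \<comment> \<open>The border rows 1 and \<open>n - 1\<close> receive the weight 1, so they are
    treated like the rows of the zig-zag.\<close>
  define X where "X r = (if r \<in> V then indet r else 1)" for r
  define Q where "Q h \<longleftrightarrow> positive_ratfun V h \<and> positive_laurent V h" for h
  have p: "p r = (c r, c r + int r)" if "r \<in> V" for r
  proof -
    have "row (p r) = int r" "max 2 (min r (n - 2)) = r"
      using that assms(2) by (auto simp: zigzag_def V_def)
    then show ?thesis
      by (simp add: c_def row_def prod_eq_iff)
  qed
  have step: "c (Suc r) = c r \<or> c (Suc r) = c r - 1" for r
  proof (cases "r \<in> {2..n - 3}")
    case True
    then have "max 2 (min r (n - 2)) = r" "max 2 (min (Suc r) (n - 2)) = Suc r"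
      using assms(1) by auto
    moreover have "p (Suc r) = (fst (p r) - 1, snd (p r)) \<or> p (Suc r) = (fst (p r), snd (p r) + 1)"
      using assms(2) True unfolding zigzag_def by (metis prod.collapse)
    ultimately show ?thesis
      by (auto simp: c_def)
  next
    case False
    then have "max 2 (min (Suc r) (n - 2)) = max 2 (min r (n - 2))"
      using assms(1) by auto
    then show ?thesis
      by (simp add: c_def)
  qed
  have Q_nz: "h \<noteq> 0" if "Q h" for h
    using that positive_ratfun_nonzero by (auto simp: Q_def)
  txt \<open>\<open>positive_ratfun\<close> is carried along because, unlike \<open>positive_laurent\<close>, it excludes \<open>0\<close>.\<close>
  have "\<exists>v. (\<forall>t. c (n - 1) \<le> t \<and> t < c (n - 1) + int (n - 1) \<longrightarrow> wedge v t (t + 1) = 1) \<and>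
    (\<forall>k. 1 \<le> k \<and> k \<le> n - 1 \<longrightarrow> wedge v (c k) (c k + int k) = X k) \<and>
    (\<forall>s t. c (n - 1) \<le> s \<and> s < t \<and> t \<le> c (n - 1) + int (n - 1) \<longrightarrow> Q (wedge v s t))"
  proof (rule zigzag_vectors)
    show "Q (X r * a)" "Q (a / X r)" if "Q a" for r a
      using that by (auto simp: Q_def X_def intro: positive_ratfun_mult positive_ratfun_divide
          positive_ratfun_indet positive_laurent_mult_indet positive_laurent_divide_indet)
  qed (use step assms(1) in \<open>auto simp: Q_def X_def V_def indet_nonzero positive_ratfun_one
        positive_ratfun_add positive_laurent_one positive_laurent_add\<close>)
  then obtain v where v:
    "\<And>t. c (n - 1) \<le> t \<Longrightarrow> t < c (n - 1) + int (n - 1) \<Longrightarrow> wedge v t (t + 1) = 1"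
    "\<And>k. 1 \<le> k \<Longrightarrow> k \<le> n - 1 \<Longrightarrow> wedge v (c k) (c k + int k) = X k"
    "\<And>s t. c (n - 1) \<le> s \<Longrightarrow> s < t \<Longrightarrow> t \<le> c (n - 1) + int (n - 1) \<Longrightarrow> Q (wedge v s t)"
    by blast
  define b where "b = c (n - 1)"
  have v1: "wedge v t (t + 1) = 1" if "b \<le> t" "t < b + int n - 1" for t
    using that assms(1) by (intro v(1)) (auto simp: b_def of_nat_diff)
  have vQ: "Q (wedge v s t)" if "b \<le> s" "s < t" "t < b + int n" for s t
    using that assms(1) by (intro v(3)) (auto simp: b_def of_nat_diff)
  note vX = v(2)
  have n: "n > 1" "n > 0"
    using assms(1) by auto
  \<comment> \<open>The last weight of the extended zig-zag, in row \<open>n - 1\<close>, is 1: this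
    is the closing condition for the \<open>n\<close> vectors.\<close>
  have vn: "wedge v b (b + int n - 1) = 1"
  proof -
    have "n - 1 \<notin> V"
      using assms(1) by (auto simp: V_def)
    then show ?thesis
      using vX[of "n - 1"] assms(1) by (simp add: b_def X_def of_nat_diff algebra_simps)
  qed
  define w where "w = wedge (antiperiodic n b v)"
  note w = antiperiodic_frieze[OF n(1) v1 vn, folded w_def]
  have wX: "w (c k) (c k + int k) = X k" if k: "1 \<le> k" "int k \<le> int n - 1" for k
  proof -
    \<comment> \<open>By nestedness the zig-zag lies over the base block, where the extension agrees
      with \<open>v\<close>.\<close>
    have "b \<le> c k \<and> c k + int k \<le> b + int (n - 1)"
      unfolding b_def using k by (intro zigzag_endpoints_mono step) auto
    moreover have "k \<le> n - 1"
      using k by simp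
    ultimately show ?thesis
      using k vX[of k] wedge_antiperiodic_base[of b "c k" n "c k + int k" v] n
      by (auto simp: w_def of_nat_diff)
  qed
  have wQ: "Q (w i j)" if ij: "1 \<le> j - i" "j - i \<le> int n - 1" for i j
  proof -
    have "i < j" "j < i + int n"
      using ij by simp_all
    then show ?thesis
      using wedge_antiperiodic_cases[OF n(2), of i j b v] vQ unfolding w_def by metis
  qed
  have glide: "w j (i + int n) = w i j" for i j
    using wedge_antiperiodic_shift(1)[OF n(2), of b v j i] by (simp add: w_def wedge_skew[of _ i j])
  \<comment> \<open>The value \<open>undefined\<close> off the table is what the extensional
    function space requires.\<close>
  define G where "G = (\<lambda>q. if q \<in> positions n then w (fst q) (snd q) else undefined)"
  have G: "G (i, j) = w i j" if "1 \<le> j - i" "j - i \<le> int n - 1" for i j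
    using that by (simp add: G_def positions_def row_def)
  have G_frieze: "frieze_with_weights n p G"
    unfolding frieze_with_weights_def
  proof (intro conjI ballI allI impI)
    show "G \<in> positions n \<rightarrow>\<^sub>E ratfuns {2..n - 2}"
      using wQ positive_ratfun_in_ratfuns
      by (intro PiE_I) (auto simp: G_def positions_def row_def Q_def V_def)
    show "G (p r) = indet r" if "r \<in> {2..n - 2}" for r
      using that p[of r] wX[of r] G[of "c r + int r" "c r"] by (auto simp: V_def X_def)
    show "G q = 1" if "row q = 1 \<or> row q = int n - 1" for q
    proof -
      obtain i j where q: "q = (i, j)"
        by (cases q)
      then have "j = i + 1 \<or> j = i + int n - 1"
        using that by (auto simp: row_def)
      then show ?thesis
        using w(1)[of i] w(2)[of i] G[of j i] n q by auto
    qed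
    show "frieze_relation n G"
      unfolding frieze_relation_def using w(3) by (auto simp: G)
  qed
  have unique: "F = G" if F: "frieze_with_weights n p F" for F
  proof
    fix q :: "int \<times> int"
    obtain i j where q: "q = (i, j)"
      by (cases q)
    show "F q = G q"
    proof (cases "q \<in> positions n")
      case False
      then show ?thesis
        using F G_frieze by (metis frieze_with_weights_def PiE_arb)
    next
      case True
      then have ij: "1 \<le> j - i" "j - i \<le> int n - 1"
        by (simp_all add: q positions_def row_def)
      have border: "F (i, j) = G (i, j)" if "j - i = 1 \<or> j - i = int n - 1" for i j
        using F G_frieze that unfolding frieze_with_weights_def row_def by auto
      have "F (i, i + int (nat (j - i))) = G (i, i + int (nat (j - i)))"
      proof (rule frieze_propagate[where c = c and n = n])
        show "F (c r, c r + int r) = G (c r, c r + int r)" if "1 \<le> r" "int r \<le> int n - 1" for r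
        proof (cases "r \<in> V")
          case True
          then show ?thesis
            using F G_frieze p[OF True] unfolding frieze_with_weights_def V_def by metis
        next
          \<comment> \<open>The only rows of the table outside \<open>V\<close> are 1 and
            \<open>n - 1\<close>.\<close>
          case False
          then show ?thesis
            using that by (intro border) (auto simp: V_def)
        qed
        show "G (i, j) \<noteq> 0" if "1 \<le> j - i" "j - i \<le> int n - 1" for i j
          using that wQ Q_nz by (simp add: G)
      qed (use F G_frieze border step ij in
          \<open>auto simp: frieze_with_weights_def frieze_relation_def\<close>)
      then show ?thesis
        using ij by (simp add: q)
    qed
  qed
  \<comment> \<open>Two glide reflections compose to the translation by \<open>n\<close>, which
    gives the period.\<close>
  have "G (i, j) = G (j, i + int n) \<and> G (i + int n, j + int n) = G (i, j) \<and>
      positive_laurent {2..n - 2} (G (i, j))" if "1 \<le> j - i" "j - i \<le> int n - 1" for i j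
    using that wQ[of j i] glide[of j i] glide[of "i + int n" j] G[of j i] G[of "i + int n" j]
      G[of "j + int n" "i + int n"] by (auto simp: Q_def V_def)
  then show ?thesis
    using G_frieze unique by blast
qed

end
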